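(* For every monotone graph $G$ with at least one edge, $\mathrm{pw}(G)\leq 2\,\psi(G)-1$.
   Context: A bipartite graph $G$ with parts $L,R$ is monotone if $L$ and $R$ can be linearly ordered so that the bipartite adjacency matrix $A$ (rows indexed by $L$, columns by $R$, in these orders) contains none of the $2\times2$ submatrices $\begin{pmatrix}1&1\\1&0\end{pmatrix}$, $\begin{pmatrix}0&1\\1&0\end{pmatrix}$, $\begin{pmatrix}0&1\\1&1\end{pmatrix}$ (on rows $i<i'$ and columns $j<j'$). $\psi(G)=\max\{d: K_{d,d}\subseteq G\}$. A path decomposition of $G=(V,E)$ is a sequence $(B_1,\dots,B_r)$ of subsets of $V$ such that every vertex lies in some $B_i$, every edge is contained in some $B_i$, and for each vertex $v$ the set $\{i: v\in B_i\}$ is an interval; its width is $\max_i|B_i|-1$, and $\mathrm{pw}(G)$ is the minimum width. *)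

theory Defs
  imports "Graph_Theory.Kuratowski"
begin

text \<open>
  Finite simple undirected graphs are the symmetric loop-free digraphs of the locale
  \<^locale>\<open>pair_graph\<close>: an undirected edge \<open>uv\<close> is the pair of arcs \<open>(u, v)\<close>, \<open>(v, u)\<close>.
\<close>

definition bipartite_parts :: "'a pair_pre_digraph \<Rightarrow> 'a set \<Rightarrow> 'a set \<Rightarrow> bool" where
  "bipartite_parts G L R \<longleftrightarrow>
     pverts G = L \<union> R \<and> L \<inter> R = {} \<and> parcs G \<subseteq> L \<times> R \<union> R \<times> L"

definition adj_entry :: "'a pair_pre_digraph \<Rightarrow> 'a \<Rightarrow> 'a \<Rightarrow> nat" where
  "adj_entry G i j = (if (i, j) \<in> parcs G then 1 else 0)"

text \<open>
  A quadruple below lists a \<open>2 \<times> 2\<close> matrix row by row. The relations \<open>r\<close> and \<open>s\<close> are reflexive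
  linear orders on rows and columns; the disequalities make them strict.
\<close>

definition monotone_graph :: "'a pair_pre_digraph \<Rightarrow> bool" where
  "monotone_graph G \<longleftrightarrow>
     (\<exists>L R r s. bipartite_parts G L R \<and> linear_order_on L r \<and> linear_order_on R s \<and>
        (\<forall>i i' j j'. (i, i') \<in> r \<and> i \<noteq> i' \<and> (j, j') \<in> s \<and> j \<noteq> j' \<longrightarrow>
           (adj_entry G i j, adj_entry G i j', adj_entry G i' j, adj_entry G i' j')
             \<notin> {(1, 1, 1, 0), (0, 1, 1, 0), (0, 1, 1, 1)}))"

text \<open>The set contains \<open>0\<close>, and it is bounded by the number of vertices if \<open>G\<close> is finite.\<close>

definition psi :: "'a pair_pre_digraph \<Rightarrow> nat" where
  "psi G = Max {d. \<exists>H :: 'a pair_pre_digraph.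
                     subgraph (with_proj H) (with_proj G) \<and> K\<^bsub>d,d\<^esub> (with_proj H)}"

definition path_decomposition :: "'a pair_pre_digraph \<Rightarrow> 'a set list \<Rightarrow> bool" where
  "path_decomposition G Bs \<longleftrightarrow>
     Bs \<noteq> [] \<and>
     (\<forall>B \<in> set Bs. B \<subseteq> pverts G) \<and>
     (\<forall>v \<in> pverts G. \<exists>B \<in> set Bs. v \<in> B) \<and>
     (\<forall>(u, v) \<in> parcs G. \<exists>B \<in> set Bs. u \<in> B \<and> v \<in> B) \<and>
     (\<forall>v \<in> pverts G. \<exists>a b. {i. i < length Bs \<and> v \<in> Bs ! i} = {a..b})"

text \<open>The type is \<^typ>\<open>int\<close> because the graph without vertices has width \<open>-1\<close>.\<close>

definition decomp_width :: "'a set list \<Rightarrow> int" where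
  "decomp_width Bs = int (Max (card ` set Bs)) - 1"

text \<open>For a finite graph the set of widths is finite, since bags are sets of vertices.\<close>

definition pathwidth :: "'a pair_pre_digraph \<Rightarrow> int" where
  "pathwidth G = Min {decomp_width Bs | Bs. path_decomposition G Bs}"

end

theory Submission
  imports Defs
begin

text \<open>
  Put \<open>d = \<psi>(G)\<close>, discard the isolated vertices and slide a \<open>d \<times> d\<close> window through the adjacency
  matrix, starting in the top left corner. The window moves down if its top row has no entry to the
  right of the window, and otherwise it moves to the right. In this way every entry is inside the
  window at some time. The only obstruction would be an entry below the window in its first
  column, but the two outlying entries would then span a rectangle which, by monotonicity, is full
  and contains \<open>K\<^bsub>d+1,d+1\<^esub>\<close>. The bags are the rows and columns of the successive windows,
  together with a singleton for each isolated vertex.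
\<close>

section \<open>Monotone matrices without zero rows and zero columns\<close>

locale monotone_matrix =
  fixes E :: "nat \<Rightarrow> nat \<Rightarrow> bool" and m n :: nat
  assumes bounded: "E i j \<Longrightarrow> i < m \<and> j < n"
    and row_nonempty: "i < m \<Longrightarrow> \<exists>j. E i j"
    and col_nonempty: "j < n \<Longrightarrow> \<exists>i. E i j"
    and cross: "E i j' \<Longrightarrow> E i' j \<Longrightarrow> i < i' \<Longrightarrow> j < j' \<Longrightarrow> E i j \<and> E i' j'"
begin

lemma transpose: "monotone_matrix (\<lambda>i j. E j i) n m"
  by unfold_locales (use bounded row_nonempty col_nonempty cross in blast)+

text \<open>A gap at column \<open>k\<close> cannot survive, because that column has some entry. If
  the entry is above row \<open>i\<close>, it crosses the entry at \<open>j\<close>; if it is below,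
  it crosses the entry at \<open>j'\<close>. In both cases \<open>cross\<close> fills the gap. This
  is why isolated vertices are set aside: an empty column could interrupt a row.\<close>

lemma row_convex:
  assumes "E i j" "E i j'" "j \<le> k" "k \<le> j'"
  shows "E i k"
proof (rule ccontr)
  assume neg: "\<not> E i k"
  then have k: "j < k" "k < j'" using assms by (metis le_neq_implies_less)+
  moreover obtain i' where "E i' k"
    using k(2) bounded[OF assms(2)] col_nonempty[of k] by auto
  ultimately show False
    using neg assms(1,2) cross[of i' k i j] cross[of i j' i' k] by (metis nat_neq_iff)
qed

lemma column_convex: "E i j \<Longrightarrow> E i' j \<Longrightarrow> i \<le> k \<Longrightarrow> k \<le> i' \<Longrightarrow> E k j"
  using monotone_matrix.row_convex[OF transpose] by blast

text \<open>\<open>cross\<close> supplies the two missing corners, convexity of rows then fills the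
  top and bottom rows, and convexity of columns fills everything between them.\<close>

lemma full_rectangle:
  assumes "E i j'" "E i' j" "i < i'" "j < j'" "p \<in> {i..i'}" "q \<in> {j..j'}"
  shows "E p q"
proof -
  have "E i j" "E i' j'" using cross[OF assms(1-4)] by auto
  then have "E i q" "E i' q"
    using row_convex[of i j j' q] row_convex[of i' j j' q] assms(1,2,6) by auto
  then show ?thesis using column_convex[of i q i' p] assms(5) by auto
qed

section \<open>The walk of the window\<close>

fun corner :: "nat \<Rightarrow> nat \<Rightarrow> nat \<times> nat" where
  "corner d 0 = (0, 0)"
| "corner d (Suc t) =
    (case corner d t of (a, c) \<Rightarrow> if \<exists>j \<ge> c + d. E a j then (a, Suc c) else (Suc a, c))"

definition in_window :: "nat \<Rightarrow> nat \<Rightarrow> nat \<Rightarrow> nat \<Rightarrow> bool" where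
  "in_window d t i j \<longleftrightarrow> i \<in> {fst (corner d t)..<fst (corner d t) + d}
     \<and> j \<in> {snd (corner d t)..<snd (corner d t) + d}"

text \<open>As the window has fixed size and never moves back, each row and each column is inside it
  during an interval of times, which is the interval condition on bags.\<close>

lemma corner_mono:
  "mono (\<lambda>t. fst (corner d t))" "mono (\<lambda>t. snd (corner d t))"
  by (auto simp: mono_iff_le_Suc split: prod.splits)

text \<open>Every step raises exactly one coordinate by one, also after the window has left the
  matrix. This determines how many steps suffice.\<close>

lemma corner_sum: "fst (corner d t) + snd (corner d t) = t"
  by (induction t) (auto split: prod.splits)

text \<open>Induction on time. The case of interest is the step that leaves the entry behind: the
  entry lies in the column or row just given up, and has to be inside the window right before the
  step.\<close>

lemma passed_entries_covered:
  assumes d: "0 < d"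
    and no_block: "\<And>a c. \<exists>p \<in> {a..a + d}. \<exists>q \<in> {c..c + d}. \<not> E p q"
    and "E i j" "i < fst (corner d t) \<or> j < snd (corner d t)"
  shows "\<exists>s<t. in_window d s i j"
  using assms(4)
proof (induction t)
  case 0
  then show ?case by simp
next
  case (Suc t)
  obtain a c where ac: "corner d t = (a, c)" by fastforce
  show ?case
  proof (cases "i < a \<or> j < c")
    case True
    then have "\<exists>s<t. in_window d s i j" using Suc.IH ac by simp
    then show ?thesis using less_SucI by blast
  next
    case False
    have "in_window d t i j"
    proof (cases "\<exists>j \<ge> c + d. E a j")
      case True
      then obtain j' where j': "c + d \<le> j'" "E a j'" by blast
      have j: "j = c" using Suc.prems False True ac by auto
      have "i < a + d"
      proof (rule ccontr)
        \<comment> \<open>Now \<open>i\<close> is at least \<open>a + d\<close> and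
          \<open>j'\<close> at least \<open>c + d\<close>, so the rectangle spanned by
          \<open>(a, j')\<close> and \<open>(i, c)\<close> has at least \<open>d + 1\<close> rows
          and columns.\<close>
        assume "\<not> i < a + d"
        then have "E p q" if "p \<in> {a..a + d}" "q \<in> {c..c + d}" for p q
          using full_rectangle[of a j' i c p q] that j j' d assms(3) by auto
        then show False using no_block by blast
      qed
      then show ?thesis using False ac j d by (auto simp: in_window_def)
    next
      case no: False
      \<comment> \<open>A step down gives up only row \<open>a\<close>, and it is taken only if that
        row has no entry to the right of the window.\<close>
      then have i: "i = a" using Suc.prems False ac by (auto split: if_splits)
      then have "j < c + d" using no assms(3) not_le by blast
      then show ?thesis using False ac i d by (auto simp: in_window_def)
    qed
    then show ?thesis by blast
  qed
qed

lemma all_entries_covered: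
  assumes "0 < d"
    and "\<And>a c. \<exists>p \<in> {a..a + d}. \<exists>q \<in> {c..c + d}. \<not> E p q"
    and "E i j"
  shows "\<exists>s<m + n. in_window d s i j"
proof -
  \<comment> \<open>Otherwise \<open>i + j\<close> would be at least \<open>m + n\<close>, although
    \<open>i < m\<close> and \<open>j < n\<close>.\<close>
  have "i < fst (corner d (m + n)) \<or> j < snd (corner d (m + n))"
    using bounded[OF assms(3)] corner_sum[of d "m + n"] by linarith
  then show ?thesis using passed_entries_covered assms by blast
qed

end

section \<open>Enumeration of linear orders, and bounds for \<open>psi\<close> and
  \<open>pathwidth\<close>\<close>

lemma finite_linear_order_enum:
  assumes "finite A" "A \<subseteq> L" "linear_order_on L r"
  obtains f where "bij_betw f {..<card A} A"
    "\<And>i j. i < j \<Longrightarrow> j < card A \<Longrightarrow> (f i, f j) \<in> r \<and> f i \<noteq> f j"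
proof -
  \<comment> \<open>The rank counts the strict predecessors within \<open>A\<close>. It is strictly
    increasing, hence injective, and by cardinality its image is an initial segment; its inverse is
    the enumeration.\<close>
  define rk where "rk x = card {y \<in> A. (y, x) \<in> r \<and> y \<noteq> x}" for x
  have tr: "trans r" and anti: "antisym r" and tot: "total_on L r"
    using assms(3) by (auto simp: order_on_defs)
  have less: "rk x < rk y" if "x \<in> A" "(x, y) \<in> r" "x \<noteq> y" for x y
    unfolding rk_def
  proof (rule psubset_card_mono)
    show "{z \<in> A. (z, x) \<in> r \<and> z \<noteq> x} \<subset> {z \<in> A. (z, y) \<in> r \<and> z \<noteq> y}"
      using that transD[OF tr] antisymD[OF anti] by blast
  qed (use assms in simp)
  have total: "(x, y) \<in> r \<or> (y, x) \<in> r" if "x \<in> A" "y \<in> A" "x \<noteq> y" for x y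
    using that tot assms(2) unfolding total_on_def by blast
  have inj: "inj_on rk A"
    by (rule inj_onI) (metis less total less_irrefl)
  have "rk x < card A" if "x \<in> A" for x
    unfolding rk_def using that assms(1) by (intro psubset_card_mono) auto
  then have "rk ` A = {..<card A}"
    using inj by (intro card_subset_eq) (auto simp: card_image)
  then have bij: "bij_betw rk A {..<card A}" using inj by (simp add: bij_betw_def)
  let ?f = "inv_into A rk"
  show ?thesis
  proof (rule that)
    show "bij_betw ?f {..<card A} A" using bij by (rule bij_betw_inv_into)
    fix i j assume ij: "i < j" "j < card A"
    then have "?f i \<in> A" "?f j \<in> A" "rk (?f i) = i" "rk (?f j) = j"
      using bij by (auto simp: bij_betw_def inv_into_into f_inv_into_f)
    then show "(?f i, ?f j) \<in> r \<and> ?f i \<noteq> ?f j"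
      using ij less total by (metis less_asym less_irrefl)
  qed
qed

lemma le_psi:
  fixes G :: "'a pair_pre_digraph"
  assumes G: "pair_graph G"
    and AB: "A \<inter> B = {}" "finite A" "finite B" "card A = d" "card B = d" "A \<times> B \<subseteq> parcs G"
      "A \<union> B \<subseteq> pverts G"
  shows "d \<le> psi G"
  unfolding psi_def
proof (rule Max_ge)
  interpret pair_graph G by fact
  let ?S = "{d. \<exists>H :: 'a pair_pre_digraph.
                  subgraph (with_proj H) (with_proj G) \<and> K\<^bsub>d,d\<^esub> (with_proj H)}"
  show "finite ?S"
  proof (rule finite_subset)
    \<comment> \<open>One side of a K_{k,k} inside \<open>G\<close> consists of \<open>k\<close>
      vertices of \<open>G\<close>.\<close>
    show "?S \<subseteq> {..card (pverts G)}"
    proof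
      fix k
      assume "k \<in> ?S"
      then obtain H :: "'a pair_pre_digraph"
        where "subgraph (with_proj H) (with_proj G)" "K\<^bsub>k,k\<^esub> (with_proj H)"
        by blast
      then obtain U where "U \<subseteq> pverts G" "card U = k"
        unfolding complete_bipartite_digraph_pair_def subgraph_def by auto
      then show "k \<in> {..card (pverts G)}"
        using card_mono[OF pair_finite_verts] by auto
    qed
  qed simp
  let ?H = "\<lparr>pverts = A \<union> B, parcs = A \<times> B \<union> B \<times> A\<rparr>"
  have K: "K\<^bsub>d,d\<^esub> (with_proj ?H)"
    using AB by (auto simp: complete_bipartite_digraph_pair_def)
  have wf: "wf_digraph (with_proj ?H)" by (auto simp: wf_digraph_def)
  have "B \<times> A \<subseteq> parcs G"
    using AB(6) sym_arcs by (auto simp: symmetric_def dest: symD)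
  then have "subgraph (with_proj ?H) (with_proj G)"
    using AB wf wf_digraph by (auto simp: subgraph_def compatible_def)
  then show "d \<in> ?S" using K by blast
qed

lemma convex_nat_set_interval:
  fixes S :: "nat set"
  assumes "finite S" "\<And>x y z. x \<in> S \<Longrightarrow> z \<in> S \<Longrightarrow> x \<le> y \<Longrightarrow> y \<le> z \<Longrightarrow> y \<in> S"
  shows "\<exists>a b. S = {a..b}"
proof (cases "S = {}")
  case True
  then have "S = {1..0}" by simp
  then show ?thesis by blast
next
  case False
  then have "Min S \<in> S" "Max S \<in> S" using assms(1) by auto
  then have "{Min S..Max S} \<subseteq> S" using assms(2)[of "Min S" "Max S"] by auto
  moreover have "S \<subseteq> {Min S..Max S}" using assms(1) by auto
  ultimately show ?thesis by (intro exI) (rule subset_antisym)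
qed

text \<open>Bags indexed by time, with the interval condition stated as betweenness, match the
  sliding window directly.\<close>

lemma pathwidth_leI:
  fixes bag :: "nat \<Rightarrow> 'a set"
  assumes fin: "finite (pverts G)"
    and N: "0 < N"
    and sub: "\<And>t. t < N \<Longrightarrow> bag t \<subseteq> pverts G"
    and vert: "\<And>v. v \<in> pverts G \<Longrightarrow> \<exists>t<N. v \<in> bag t"
    and arc: "\<And>u v. (u, v) \<in> parcs G \<Longrightarrow> \<exists>t<N. u \<in> bag t \<and> v \<in> bag t"
    and convex: "\<And>v t t' t''. v \<in> bag t \<Longrightarrow> v \<in> bag t'' \<Longrightarrow> t \<le> t' \<Longrightarrow> t' \<le> t'' \<Longrightarrow> t'' < N
      \<Longrightarrow> v \<in> bag t'"
    and card: "\<And>t. t < N \<Longrightarrow> card (bag t) \<le> w"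
  shows "pathwidth G \<le> int w - 1"
proof -
  define Bs where "Bs = map bag [0..<N]"
  have set: "set Bs = bag ` {..<N}" by (auto simp: Bs_def)
  have "\<exists>a b. {i. i < length Bs \<and> v \<in> Bs ! i} = {a..b}" for v
    by (rule convex_nat_set_interval) (auto simp: Bs_def intro: convex)
  then have Bs: "path_decomposition G Bs"
    using N sub vert arc unfolding path_decomposition_def set by (auto simp: Bs_def) blast+
  let ?W = "{decomp_width Bs | Bs. path_decomposition G Bs}"
  \<comment> \<open>\<open>Min\<close> is a lower bound only for a finite set; here bag sizes are
    bounded by the number of vertices.\<close>
  have "?W \<subseteq> (\<lambda>k. int k - 1) ` {..card (pverts G)}"
  proof clarsimp
    fix Cs assume Cs: "path_decomposition G Cs"
    then have "card ` set Cs \<noteq> {}" by (auto simp: path_decomposition_def)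
    then have "Max (card ` set Cs) \<in> card ` set Cs" by (intro Max_in) auto
    then have "Max (card ` set Cs) \<le> card (pverts G)"
      using Cs card_mono[OF fin] by (auto simp: path_decomposition_def)
    then show "decomp_width Cs \<in> (\<lambda>k. int k - 1) ` {..card (pverts G)}"
      by (auto simp: decomp_width_def)
  qed
  then have "finite ?W" by (rule finite_subset) simp
  then have "pathwidth G \<le> decomp_width Bs"
    unfolding pathwidth_def using Bs by (intro Min_le) auto
  also have "Max (card ` set Bs) \<le> w"
    using N card set by (subst Max_le_iff) auto
  then have "decomp_width Bs \<le> int w - 1" by (simp add: decomp_width_def)
  finally show ?thesis .
qed

section \<open>From the graph to its matrix, and from windows to bags\<close>

theorem theorem20:
  fixes G :: "'a pair_pre_digraph"
  assumes "pair_graph G"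
    and "monotone_graph G"
    and "parcs G \<noteq> {}"
  shows "pathwidth G \<le> 2 * int (psi G) - 1"
proof -
  interpret pair_graph G by fact
  have sym: "(v, u) \<in> parcs G" if "(u, v) \<in> parcs G" for u v
    using that sym_arcs by (auto simp: symmetric_def dest: symD)
  from assms(2) obtain L R r s where
    parts: "bipartite_parts G L R" and r: "linear_order_on L r" and s: "linear_order_on R s"
    and mon: "\<And>i i' j j'. (i, i') \<in> r \<Longrightarrow> i \<noteq> i' \<Longrightarrow> (j, j') \<in> s \<Longrightarrow> j \<noteq> j' \<Longrightarrow>
           (adj_entry G i j, adj_entry G i j', adj_entry G i' j, adj_entry G i' j')
             \<notin> {(1, 1, 1, 0), (0, 1, 1, 0), (0, 1, 1, 1)}"
    unfolding monotone_graph_def by blast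
  have V: "pverts G = L \<union> R" and disj: "L \<inter> R = {}"
    and arcs: "parcs G \<subseteq> L \<times> R \<union> R \<times> L"
    using parts by (auto simp: bipartite_parts_def)
  have fin: "finite L" "finite R" using pair_finite_verts V by auto
  define L' where "L' = {u \<in> L. \<exists>v. (u, v) \<in> parcs G}"
  define R' where "R' = {u \<in> R. \<exists>v. (u, v) \<in> parcs G}"
  have fin': "finite L'" "finite R'" using fin by (auto simp: L'_def R'_def)
  have arcs': "u \<in> L' \<and> v \<in> R' \<or> u \<in> R' \<and> v \<in> L'" if "(u, v) \<in> parcs G" for u v
    using that sym arcs by (auto simp: L'_def R'_def)
  define m n where "m = card L'" and "n = card R'"
  obtain f where f: "bij_betw f {..<m} L'"
    and f_less: "\<And>i j. i < j \<Longrightarrow> j < m \<Longrightarrow> (f i, f j) \<in> r \<and> f i \<noteq> f j"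
    using finite_linear_order_enum[OF fin'(1) _ r] unfolding m_def L'_def by blast
  obtain g where g: "bij_betw g {..<n} R'"
    and g_less: "\<And>i j. i < j \<Longrightarrow> j < n \<Longrightarrow> (g i, g j) \<in> s \<and> g i \<noteq> g j"
    using finite_linear_order_enum[OF fin'(2) _ s] unfolding n_def R'_def by blast
  have f_in: "f i \<in> L'" if "i < m" for i using f that by (auto simp: bij_betw_def)
  have g_in: "g i \<in> R'" if "i < n" for i using g that by (auto simp: bij_betw_def)
  have f_inj: "f i = f j \<longleftrightarrow> i = j" if "i < m" "j < m" for i j
    using f that by (auto simp: bij_betw_def inj_on_def)
  have g_inj: "g i = g j \<longleftrightarrow> i = j" if "i < n" "j < n" for i j
    using g that by (auto simp: bij_betw_def inj_on_def)
  have f_ex: "\<exists>i<m. f i = u" if "u \<in> L'" for u using f that by (auto simp: bij_betw_def)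
  have g_ex: "\<exists>i<n. g i = u" if "u \<in> R'" for u using g that by (auto simp: bij_betw_def)
  have disj': "L' \<inter> R' = {}" "L' \<union> R' \<subseteq> pverts G" using disj V by (auto simp: L'_def R'_def)
  have fg: "f i \<noteq> g j" if "i < m" "j < n" for i j using f_in g_in disj' that by fastforce
  define E where "E i j \<longleftrightarrow> i < m \<and> j < n \<and> (f i, g j) \<in> parcs G" for i j
  interpret monotone_matrix E m n
  proof
    show "E i j \<Longrightarrow> i < m \<and> j < n" for i j by (simp add: E_def)
    show "\<exists>j. E i j" if i: "i < m" for i
    proof -
      obtain v where v: "(f i, v) \<in> parcs G" using f_in[OF i] by (auto simp: L'_def)
      then have "v \<in> R'" using arcs' f_in[OF i] disj' by blast
      then show ?thesis using g_ex v i by (auto simp: E_def)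
    qed
    show "\<exists>i. E i j" if j: "j < n" for j
    proof -
      obtain v where v: "(g j, v) \<in> parcs G" using g_in[OF j] by (auto simp: R'_def)
      then have "v \<in> L'" using arcs' g_in[OF j] disj' by blast
      then show ?thesis using f_ex sym[OF v] j by (auto simp: E_def)
    qed
    \<comment> \<open>The three excluded submatrices are exactly those with ones on the antidiagonal
      and at least one zero on the diagonal.\<close>
    show "E i j \<and> E i' j'" if "E i j'" "E i' j" "i < i'" "j < j'" for i i' j j'
    proof -
      have "i < m" "i' < m" "j < n" "j' < n" using that by (auto simp: E_def)
      then show ?thesis
        using mon[of "f i" "f i'" "g j" "g j'"] f_less[of i i'] g_less[of j j'] that
        by (auto simp: E_def adj_entry_def split: if_splits)
    qed
  qed
  define d where "d = psi G"
  have clique: "k \<le> d" if k: "\<And>p q. p \<in> {a..<a + k} \<Longrightarrow> q \<in> {c..<c + k} \<Longrightarrow> E p q" for a c k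
  proof (cases "k = 0")
    case False
    \<comment> \<open>A nonempty full block lies inside the matrix because its entries do; only
      there are \<open>f\<close> and \<open>g\<close> known to be injective.\<close>
    then have lt: "p < m" if "p \<in> {a..<a + k}" for p using k[OF that, of c] bounded by auto
    have lt': "q < n" if "q \<in> {c..<c + k}" for q using k[OF _ that, of a] False bounded by auto
    have "inj_on f {a..<a + k}" "inj_on g {c..<c + k}"
      using lt lt' f_inj g_inj by (auto simp: inj_on_def)
    moreover have "f ` {a..<a + k} \<subseteq> L'" "g ` {c..<c + k} \<subseteq> R'"
      using lt lt' f_in g_in by blast+
    moreover have "f ` {a..<a + k} \<times> g ` {c..<c + k} \<subseteq> parcs G"
      using k by (auto simp: E_def)
    ultimately show ?thesis
      unfolding d_def using disj'
      by (intro le_psi[OF assms(1), of "f ` {a..<a + k}" "g ` {c..<c + k}"])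
        (auto simp: card_image)
  qed simp
  obtain u v where "(u, v) \<in> parcs G" using assms(3) by auto
  then obtain u v where "(u, v) \<in> parcs G" "u \<in> L'" "v \<in> R'" using arcs' sym by blast
  then obtain i0 j0 where "E i0 j0" using f_ex g_ex by (fastforce simp: E_def)
  then have d: "0 < d" using clique[of i0 1 j0] by simp
  \<comment> \<open>A full block of side \<open>d + 1\<close> would give
    \<open>Suc d \<le> d\<close> by \<open>clique\<close>.\<close>
  have no_block: "\<exists>p \<in> {a..a + d}. \<exists>q \<in> {c..c + d}. \<not> E p q" for a c
    using clique[of a "Suc d" c] by (fastforce simp: less_Suc_eq_le)
  define I where "I = pverts G - (L' \<union> R')"
  have "finite I" using pair_finite_verts by (simp add: I_def)
  then obtain h where h: "bij_betw h {..<card I} I"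
    using ex_bij_betw_nat_finite by (metis atLeast0LessThan)
  have h_in: "h i \<in> I" if "i < card I" for i using h that by (auto simp: bij_betw_def)
  \<comment> \<open>The window may protrude from the matrix, and indices beyond \<open>m\<close> or
    \<open>n\<close> name no vertex; hence the truncation.\<close>
  define rows where "rows t = {fst (corner d t)..<fst (corner d t) + d} \<inter> {..<m}" for t
  define cols where "cols t = {snd (corner d t)..<snd (corner d t) + d} \<inter> {..<n}" for t
  define bag where
    "bag t = (if t < m + n then f ` rows t \<union> g ` cols t else {h (t - (m + n))})" for t
  have window: "\<exists>t<m + n. f i \<in> bag t \<and> g j \<in> bag t" if "E i j" for i j
    using all_entries_covered[OF d no_block that] bounded[OF that]
    by (fastforce simp: in_window_def bag_def rows_def cols_def)
  have sub: "bag t \<subseteq> L' \<union> R'" if "t < m + n" for t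
    using that f_in g_in by (auto simp: bag_def rows_def cols_def)
  have f_bag: "f i \<in> bag t \<longleftrightarrow> i \<in> rows t" if "i < m" "t < m + n" for i t
    using that f_inj fg by (auto simp: bag_def rows_def cols_def)
  have g_bag: "g j \<in> bag t \<longleftrightarrow> j \<in> cols t" if "j < n" "t < m + n" for j t
    using that g_inj fg fg[symmetric] by (auto simp: bag_def rows_def cols_def)
  let ?N = "m + n + card I"
  have arc_bag: "\<exists>t<m + n. u \<in> bag t \<and> v \<in> bag t" if uv: "(u, v) \<in> parcs G" for u v
  proof -
    have *: "\<exists>t<m + n. u \<in> bag t \<and> v \<in> bag t" 
      if a: "(u, v) \<in> parcs G" "u \<in> L'" "v \<in> R'" for u v
    proof -
      obtain i j where "i < m" "f i = u" "j < n" "g j = v" using a f_ex g_ex by blast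
      then show ?thesis using window[of i j] a(1) by (auto simp: E_def)
    qed
    show ?thesis using arcs'[OF uv] *[OF uv] *[OF sym[OF uv]] by blast
  qed
  have "pathwidth G \<le> int (2 * d) - 1"
  proof (rule pathwidth_leI[where N = ?N and bag = bag])
    show "finite (pverts G)" by (fact pair_finite_verts)
    show "0 < ?N" using bounded[OF \<open>E i0 j0\<close>] by simp
    show "bag t \<subseteq> pverts G" if "t < ?N" for t
    proof (cases "t < m + n")
      case True
      then show ?thesis using sub disj' by blast
    next
      case False
      then show ?thesis using that h_in[of "t - (m + n)"] by (auto simp: bag_def I_def)
    qed
    show "\<exists>t<?N. u \<in> bag t \<and> v \<in> bag t" if "(u, v) \<in> parcs G" for u v
      using arc_bag[OF that] trans_less_add1 by blast
    show "\<exists>t<?N. v \<in> bag t" if v: "v \<in> pverts G" for v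
    proof (cases "v \<in> L' \<union> R'")
      case True
      then obtain u where "(v, u) \<in> parcs G" by (auto simp: L'_def R'_def)
      then show ?thesis using arc_bag trans_less_add1 by blast
    next
      case False
      then have "v \<in> h ` {..<card I}" using v h by (simp add: I_def bij_betw_def)
      then obtain k where "k < card I" "h k = v" by auto
      then show ?thesis by (intro exI[of _ "m + n + k"]) (simp add: bag_def)
    qed
    show "card (bag t) \<le> 2 * d" for t
    proof (cases "t < m + n")
      case True
      have "card (rows t) \<le> d" "card (cols t) \<le> d"
        unfolding rows_def cols_def by (rule order_trans[OF card_mono[OF _ Int_lower1]]; simp)+
      moreover have "card (f ` rows t) \<le> card (rows t)" "card (g ` cols t) \<le> card (cols t)"
        unfolding rows_def cols_def by (simp_all add: card_image_le)
      ultimately show ?thesis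
        using True card_Un_le[of "f ` rows t" "g ` cols t"] by (simp add: bag_def)
    \<comment> \<open>A singleton bag respects the bound because \<open>d\<close> is
      positive.\<close>
    qed (use d in \<open>simp add: bag_def\<close>)
    show "v \<in> bag t'"
      if v: "v \<in> bag t" "v \<in> bag t''" and t: "t \<le> t'" "t' \<le> t''" "t'' < ?N" for v t t' t''
    proof (cases "t'' < m + n")
      case True
      \<comment> \<open>Presence at time \<open>t\<close> keeps the index of \<open>v\<close> below
        the far edge of the window at time \<open>t'\<close>, and presence at \<open>t''\<close>
        keeps it at or beyond the near edge.\<close>
      have a: "fst (corner d t) \<le> fst (corner d t')" "fst (corner d t') \<le> fst (corner d t'')"
        "snd (corner d t) \<le> snd (corner d t')" "snd (corner d t') \<le> snd (corner d t'')"
        using corner_mono t by (auto dest: monoD)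
      consider i where "i < m" "v = f i" | j where "j < n" "v = g j"
        using sub[OF True] v(2) f_ex g_ex by blast
      then show ?thesis
      proof cases
        case 1
        then show ?thesis using v t True f_bag a by (auto simp: rows_def)
      next
        case 2
        then show ?thesis using v t True g_bag a by (auto simp: cols_def)
      qed
    next
      case False
      then have v'': "v = h (t'' - (m + n))" "t'' - (m + n) < card I"
        using v t by (auto simp: bag_def)
      \<comment> \<open>An isolated vertex is in no window bag, and \<open>h\<close> is injective,
        so it occurs at one time only and \<open>t\<close>, \<open>t'\<close>, \<open>t''\<close>
        coincide.\<close>
      then have "v \<notin> L' \<union> R'" using h_in by (auto simp: I_def)
      then have "\<not> t < m + n" using sub v by blast
      then have "h (t - (m + n)) = h (t'' - (m + n))" "t - (m + n) < card I"
        using v v'' t by (auto simp: bag_def)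
      then have "t - (m + n) = t'' - (m + n)"
        using h v'' by (auto simp: bij_betw_def inj_on_def)
      then have "t' = t''" using t \<open>\<not> t < m + n\<close> False by linarith
      then show ?thesis using v by simp
    qed
  qed
  then show ?thesis by (simp add: d_def)
qed

end
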